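(* Let $p>5$ be a prime, let $\zeta$ be any primitive tenth root of unity, and let $$G_p(x)=\prod_{k=1}^{(p-1)/2}\left(x-e^{2\pi i k^2/p}\right).$$ If $p\equiv21\pmod{40}$, then $$G_p(\zeta)=(-1)^{\left|\left\{1\le k\le \frac{p+9}{10}:\ \left(\frac kp\right)=-1\right\}\right|}.$$ If $p\equiv29\pmod{40}$, then $$G_p(\zeta)=(-1)^{\left|\left\{1\le k\le \frac{p+1}{10}:\ \left(\frac kp\right)=-1\right\}\right|}\,\zeta^{2}.$$
   Context: $\left(\frac{\cdot}{p}\right)$ denotes the Legendre symbol modulo $p$. *)

theory Defs
  imports "HOL-Analysis.Analysis" "HOL-Number_Theory.Number_Theory"
begin

definition primitive_root_of_unity :: "nat \<Rightarrow> complex \<Rightarrow> bool" where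
  "primitive_root_of_unity n z \<longleftrightarrow> 0 < n \<and> z ^ n = 1 \<and> (\<forall>m. 0 < m \<and> m < n \<longrightarrow> z ^ m \<noteq> 1)"

(* For odd p the division by 2 is exact. *)
definition G :: "nat \<Rightarrow> complex \<Rightarrow> complex" where
  "G p x = (\<Prod>k = 1..(p - 1) div 2. (x - exp (2 * of_real pi * \<i> * of_nat (k ^ 2) / of_nat p)))"

end

theory Submission
  imports Defs
begin

text \<open>Write \<open>H\<^sub>s(x)\<close> for the product of \<open>x - \<xi>\<^sup>r\<close> over the residues \<open>r\<close> with Legendre
  symbol \<open>s\<close>, so that \<open>G\<^sub>p = H\<^sub>1\<close>. For \<open>p\<close> congruent to 21 or 29 modulo 40, the number 2 is a
  nonresidue and 5 is a residue, which gives \<open>H\<^sub>1(x) H\<^sub>1(-x) = H\<^sub>-\<^sub>1(x\<^sup>2)\<close> and shows that the product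
  of \<open>H\<^sub>1\<close> over the primitive fifth roots of unity is 1. Together with
  \<open>H\<^sub>1(x) H\<^sub>-\<^sub>1(x) (x - 1) = x\<^sup>p - 1\<close> and the self-reciprocity of \<open>H\<^sub>1\<close>, this determines the square
  of \<open>H\<^sub>1(z)\<close> and the ratio of \<open>H\<^sub>1(z\<^sup>3)\<close> to \<open>H\<^sub>1(z)\<close> for every primitive tenth root \<open>z\<close>. As all of
  these arise from \<open>c = exp(\<pi>i/5)\<close> by repeated cubing, only the sign at \<open>c\<close> remains. Pairing \<open>r\<close>
  with \<open>p - r\<close> makes \<open>H\<^sub>1(c)\<close> a power of \<open>c\<close> times the product of
  \<open>2 (cos(2\<pi>/10) - cos(2\<pi>r/p))\<close> over the residues \<open>r < p/2\<close>, whose sign counts the residues below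
  \<open>p/10\<close>.\<close>

section \<open>Primitive tenth roots of unity\<close>

lemma tenth_root_power:
  assumes "z ^ 5 = (- 1 :: complex)"
  shows "z ^ (10 * m + n) = z ^ n"
proof -
  have "z ^ 10 = 1"
    using power_add[of z 5 5] assms by simp
  hence "z ^ (10 * m) = 1"
    by (simp only: power_mult power_one)
  thus ?thesis
    by (simp only: power_add mult_1)
qed

lemma tenth_root_power_power:
  assumes "z ^ 5 = (- 1 :: complex)" "a * b = 10 * m + n"
  shows "(z ^ a) ^ b = z ^ n"
  using tenth_root_power[OF assms(1)] by (simp only: assms(2) flip: power_mult)

text \<open>The hypotheses are the working form of primitivity: \<open>z ^ 5 = - 1\<close> leaves
  order 2 or 10, and \<open>z\<^sup>2 \<noteq> 1\<close> excludes 2. The conclusion makes cubing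
  preserve this form and lets \<open>z ^ 6 - 1\<close> be cancelled later.\<close>

lemma tenth_root_sixth:
  assumes "z ^ 5 = (- 1 :: complex)" "z\<^sup>2 \<noteq> 1"
  shows "z ^ 6 \<noteq> 1"
proof
  assume "z ^ 6 = 1"
  hence "- z = 1"
    using power_add[of z 5 1] assms(1) by simp
  hence "(- z)\<^sup>2 = 1"
    by simp
  thus False
    using assms(2) by simp
qed

lemma tenth_root_cube:
  assumes "z ^ 5 = (- 1 :: complex)" "z\<^sup>2 \<noteq> 1"
  shows "(z ^ 3) ^ 5 = - 1" "(z ^ 3)\<^sup>2 \<noteq> 1"
proof -
  have "(z ^ 3) ^ 5 = (z ^ 5) ^ 3"
    by (simp flip: power_mult)
  thus "(z ^ 3) ^ 5 = - 1"
    using assms(1) by simp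
  show "(z ^ 3)\<^sup>2 \<noteq> 1"
    using tenth_root_sixth[OF assms] by (simp flip: power_mult)
qed

lemma cis_36: "cis (pi / 5) ^ 5 = - 1" "(cis (pi / 5))\<^sup>2 \<noteq> 1"
proof -
  show "cis (pi / 5) ^ 5 = - 1"
    by (simp add: Complex.DeMoivre)
  have "0 < sin (2 * (pi / 5))"
    by (rule sin_gt_zero) auto
  moreover have "Im ((cis (pi / 5))\<^sup>2) = sin (2 * (pi / 5))"
    by (simp add: Complex.DeMoivre)
  ultimately show "(cis (pi / 5))\<^sup>2 \<noteq> 1"
    by auto
qed

lemma primitive_tenth_root_cases:
  assumes "primitive_root_of_unity 10 z"
  obtains k where "k \<in> {1, 3, 7, 9}" "z = cis (pi / 5) ^ k"
proof -
  have z: "z ^ 10 = 1" "z ^ 5 \<noteq> 1" "z ^ 2 \<noteq> 1"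
    using assms by (auto simp: primitive_root_of_unity_def)
  have "z \<in> (\<lambda>j. cis (2 * pi * real j / real 10)) ` {..<10}"
    using z(1) bij_betw_imp_surj_on[OF Complex.bij_betw_roots_unity[of 10]] by simp
  then obtain k where k: "k < 10" "z = cis (pi / 5) ^ k"
    by (auto simp: Complex.DeMoivre mult.commute)
  have unity: "cis (pi / 5) ^ (10 * j) = 1" for j
    using tenth_root_power[OF cis_36(1), of j 0] by simp
  have "odd k"
  proof
    assume "even k"
    then obtain j where "k = 2 * j" ..
    thus False
      using z(2) unity[of j] unfolding k(2) by (simp flip: power_mult)
  qed
  moreover have "k \<noteq> 5"
    using z(3) unity[of 1] unfolding k(2) by (auto simp flip: power_mult)
  moreover have "k = 0 \<or> k = 1 \<or> k = 2 \<or> k = 3 \<or> k = 4 \<or> k = 5 \<or> k = 6 \<or> k = 7 \<or> k = 8 \<or> k = 9"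
    using k(1) by presburger
  ultimately have "k \<in> {1, 3, 7, 9}"
    by auto
  thus ?thesis
    using that k(2) by blast
qed

text \<open>The units modulo 10 are the powers 1, 3, 9, 7 of 3, so repeated cubing, started at one
  primitive tenth root, reaches all four.\<close>

lemma primitive_tenth_root_induct:
  assumes "primitive_root_of_unity 10 z"
  assumes start: "Q (cis (pi / 5))"
  assumes cube: "\<And>y. y ^ 5 = - 1 \<Longrightarrow> y\<^sup>2 \<noteq> 1 \<Longrightarrow> Q y \<Longrightarrow> Q (y ^ 3)"
  shows "Q z"
proof -
  define c where "c = cis (pi / 5)"
  note c = cis_36[folded c_def]
  note c3 = tenth_root_cube[OF c]
  note c9 = tenth_root_cube[OF c3]
  have Q: "Q c" "Q (c ^ 3)" "Q ((c ^ 3) ^ 3)" "Q (((c ^ 3) ^ 3) ^ 3)"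
    using start cube[OF c] cube[OF c3] cube[OF c9] by (simp_all only: c_def[symmetric])
  moreover have "((c ^ 3) ^ 3) ^ 3 = c ^ 7" "(c ^ 3) ^ 3 = c ^ 9"
    using tenth_root_power[OF c(1), of 2 7] by (simp_all flip: power_mult)
  ultimately have "Q (c ^ k)" if "k \<in> {1, 3, 7, 9}" for k
    using that by auto
  thus ?thesis
    using assms(1) primitive_tenth_root_cases unfolding c_def by metis
qed

section \<open>Residue classes and the Legendre symbol\<close>

locale odd_prime =
  fixes p :: nat
  assumes prime_p: "prime p" and p_gt_2: "2 < p"
begin

definition S :: "int \<Rightarrow> nat set" where
  "S s = {r \<in> {1..<p}. Legendre (int r) (int p) = s}"

definition \<xi> :: complex where
  "\<xi> = cis (2 * pi / real p)"

definition H :: "int \<Rightarrow> complex \<Rightarrow> complex" where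
  "H s x = (\<Prod>r\<in>S s. x - \<xi> ^ r)"

lemma p_pos: "0 < p" and odd_p: "odd p"
  using p_gt_2 prime_p prime_odd_nat by auto

lemma finite_S [simp]: "finite (S s)"
  by (simp add: S_def)

text \<open>Two elements of {-1, 0, 1} differ by at most 2 < \<open>p\<close>, so congruences such
  as Euler's criterion become equalities.\<close>

lemma Legendre_eqI:
  assumes "[Legendre a (int p) = s] (mod int p)" "s \<in> {-1, 0, 1}"
  shows "Legendre a (int p) = s"
proof -
  have "Legendre a (int p) \<in> {-1, 0, 1}"
    by (auto simp: Legendre_def)
  hence "\<bar>Legendre a (int p) - s\<bar> < int p"
    using assms(2) p_gt_2 by auto
  moreover have "int p dvd Legendre a (int p) - s"
    using assms(1) by (simp add: cong_iff_dvd_diff)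
  ultimately show ?thesis
    using dvd_imp_le_int[of "Legendre a (int p) - s" "int p"] by fastforce
qed

lemma Legendre_mult:
  "Legendre (a * b) (int p) = Legendre a (int p) * Legendre b (int p)"
proof (rule Legendre_eqI)
  note E = euler_criterion[OF prime_p p_gt_2]
  have "[Legendre a (int p) * Legendre b (int p)
          = a ^ ((p - 1) div 2) * b ^ ((p - 1) div 2)] (mod int p)"
    by (intro cong_mult E)
  thus "[Legendre (a * b) (int p) = Legendre a (int p) * Legendre b (int p)] (mod int p)"
    using E[of "a * b"] by (metis cong_sym cong_trans power_mult_distrib)
qed (auto simp: Legendre_def)

lemma Legendre_cong:
  assumes "[a = b] (mod int p)"
  shows "Legendre a (int p) = Legendre b (int p)"
proof -
  have "[a = 0] (mod int p) \<longleftrightarrow> [b = 0] (mod int p)"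
    using assms cong_sym cong_trans by blast
  moreover have "QuadRes (int p) a \<longleftrightarrow> QuadRes (int p) b"
    unfolding QuadRes_def using assms cong_sym cong_trans by blast
  ultimately show ?thesis
    by (simp add: Legendre_def)
qed

lemma Legendre_mod: "Legendre (int (n mod p)) (int p) = Legendre (int n) (int p)"
  by (rule Legendre_cong) (simp add: cong_def zmod_int)

lemma Legendre_eq_0_iff: "Legendre (int n) (int p) = 0 \<longleftrightarrow> p dvd n"
  by (auto simp: Legendre_def cong_0_iff)

lemma Legendre_minus_one:
  assumes "p mod 4 = 1"
  shows "Legendre (- 1) (int p) = 1"
proof (rule Legendre_eqI)
  have "even ((p - 1) div 2)"
    using assms by presburger
  thus "[Legendre (- 1) (int p) = 1] (mod int p)"
    using euler_criterion[OF prime_p p_gt_2, of "- 1"] by simp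
qed auto

text \<open>Multiplication by \<open>a\<close> is injective modulo \<open>p\<close> and multiplies
  the symbol by \<open>t\<close>; surjectivity comes from counting.\<close>

lemma S_mult_bij:
  assumes "Legendre (int a) (int p) = t" "t \<noteq> 0"
  shows "bij_betw (\<lambda>r. a * r mod p) (S s) (S (t * s))"
proof -
  have ndvd: "\<not> p dvd a"
    using assms Legendre_eq_0_iff by blast
  have t: "t * t = 1"
    using assms by (auto simp: Legendre_def split: if_splits)
  have inj: "inj_on (\<lambda>r. a * r mod p) {1..<p}"
  proof (rule inj_onI)
    fix x y assume xy: "x \<in> {1..<p}" "y \<in> {1..<p}" "a * x mod p = a * y mod p"
    hence "[a * x = a * y] (mod p)"
      by (simp add: cong_def)
    moreover have "coprime a p"
      using ndvd prime_p by (metis coprime_commute prime_imp_coprime)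
    ultimately have "[x = y] (mod p)"
      using cong_mult_lcancel_nat by blast
    thus "x = y"
      using xy by (simp add: cong_def)
  qed
  have maps: "a * r mod p \<in> S (t * s)" if "r \<in> S s" for r s
  proof -
    from that have r: "\<not> p dvd r" "Legendre (int r) (int p) = s"
      by (auto simp: S_def dvd_imp_le nat_dvd_not_less)
    hence "\<not> p dvd a * r"
      using ndvd prime_p by (simp add: prime_dvd_mult_iff)
    hence "a * r mod p \<in> {1..<p}"
      using p_pos by (simp add: Suc_le_eq mod_greater_zero_iff_not_dvd)
    moreover have "Legendre (int (a * r mod p)) (int p) = t * s"
      unfolding Legendre_mod using r assms by (simp add: Legendre_mult)
    ultimately show ?thesis by (simp add: S_def)
  qed
  have inj': "inj_on (\<lambda>r. a * r mod p) (S u)" for u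
    by (rule inj_on_subset[OF inj]) (auto simp: S_def)
  \<comment> \<open>A second multiplication leads from \<open>S (t * s)\<close> back to
    \<open>S s\<close>, because \<open>t * t = 1\<close>; this bounds the size of the
    target.\<close>
  have "card (S (t * s)) \<le> card (S (t * (t * s)))"
    by (rule card_inj_on_le[OF inj']) (use maps in auto)
  hence "card (S (t * s)) \<le> card (S s)"
    using t by (simp flip: mult.assoc)
  hence "(\<lambda>r. a * r mod p) ` S s = S (t * s)"
    using maps by (intro card_seteq) (auto simp: card_image[OF inj'])
  thus ?thesis
    using inj' by (simp add: bij_betw_def)
qed

section \<open>Powers of \<open>\<xi>\<close> and the factorization of
  \<open>x ^ p - 1\<close>\<close>

lemma xi_power_p: "\<xi> ^ p = 1"
  using p_pos by (simp add: \<xi>_def Complex.DeMoivre)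

lemma xi_power_mod: "\<xi> ^ (n mod p) = \<xi> ^ n"
proof -
  have "\<xi> ^ n = \<xi> ^ (p * (n div p) + n mod p)"
    by simp
  also have "\<dots> = \<xi> ^ (n mod p)"
    by (simp only: power_add power_mult xi_power_p) simp
  finally show ?thesis ..
qed

text \<open>Replacing \<open>\<xi>\<close> by \<open>\<xi> ^ a\<close> preserves or swaps residues
  and nonresidues according to the symbol of \<open>a\<close>: the Galois action behind the product
  identities for \<open>H\<close>.\<close>

lemma prod_S_mult:
  assumes "Legendre (int a) (int p) = t" "t \<noteq> 0"
  shows "(\<Prod>r\<in>S s. f (\<xi> ^ (a * r))) = (\<Prod>r\<in>S (t * s). f (\<xi> ^ r))"
proof -
  have "(\<Prod>r\<in>S (t * s). f (\<xi> ^ r)) = (\<Prod>r\<in>S s. f (\<xi> ^ (a * r mod p)))"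
    by (rule prod.reindex_bij_betw[OF S_mult_bij[OF assms], symmetric])
  thus ?thesis
    by (simp add: xi_power_mod)
qed

text \<open>Modulo a prime, \<open>k\<close> and \<open>p - k\<close> are the only roots of their
  common square, so the lower half meets every nonzero square exactly once.\<close>

lemma squares_bij: "bij_betw (\<lambda>k. k\<^sup>2 mod p) {1..(p - 1) div 2} (S 1)"
proof -
  have "inj_on (\<lambda>k. k\<^sup>2 mod p) {1..(p - 1) div 2}"
  proof (rule inj_onI)
    fix x y assume xy: "x \<in> {1..(p - 1) div 2}" "y \<in> {1..(p - 1) div 2}" "x\<^sup>2 mod p = y\<^sup>2 mod p"
    hence "int p dvd (int x)\<^sup>2 - (int y)\<^sup>2"
      by (metis mod_eq_dvd_iff of_nat_mod of_nat_power)
    hence "int p dvd (int x - int y) * (int x + int y)"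
      by (simp add: power2_eq_square algebra_simps)
    hence "int p dvd int x - int y \<or> int p dvd int x + int y"
      using prime_p prime_dvd_mult_iff[of "int p"] by simp
    thus "x = y"
    proof
      assume "int p dvd int x - int y"
      thus ?thesis
        using xy dvd_imp_le_int[of "int x - int y" "int p"] by fastforce
    next
      assume "int p dvd int x + int y"
      thus ?thesis
        using xy zdvd_imp_le[of "int p" "int x + int y"] by fastforce
    qed
  qed
  moreover have "(\<lambda>k. k\<^sup>2 mod p) ` {1..(p - 1) div 2} = S 1"
  proof (intro equalityI subsetI)
    fix r assume "r \<in> (\<lambda>k. k\<^sup>2 mod p) ` {1..(p - 1) div 2}"
    then obtain k where k: "1 \<le> k" "k \<le> (p - 1) div 2" "r = k\<^sup>2 mod p" by auto
    hence "\<not> p dvd k"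
      using nat_dvd_not_less[of k p] by simp
    hence "\<not> p dvd k\<^sup>2"
      using prime_p prime_dvd_power by blast
    moreover have "QuadRes (int p) ((int k)\<^sup>2)"
      unfolding QuadRes_def using cong_refl by blast
    ultimately have "Legendre (int (k\<^sup>2)) (int p) = 1"
      using Legendre_eq_0_iff[of "k\<^sup>2"] by (auto simp: Legendre_def split: if_splits)
    thus "r \<in> S 1"
      using \<open>\<not> p dvd k\<^sup>2\<close> p_pos k
      by (simp add: S_def Legendre_mod Suc_le_eq mod_greater_zero_iff_not_dvd del: of_nat_power)
  next
    fix r assume "r \<in> S 1"
    hence r: "1 \<le> r" "r < p" "Legendre (int r) (int p) = 1"
      by (auto simp: S_def)
    then obtain y where y: "[y\<^sup>2 = int r] (mod int p)"
      by (auto simp: Legendre_def QuadRes_def split: if_splits)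
    define z where "z = nat (y mod int p)"
    have z: "int z = y mod int p"
      using p_pos by (simp add: z_def)
    have "int (z\<^sup>2 mod p) = int r mod int p"
      using y by (simp add: z of_nat_mod cong_def power_mod)
    hence zr: "z\<^sup>2 mod p = r"
      using r by (simp add: of_nat_mod[symmetric])
    have z_less: "z < p"
      using z p_pos by (metis of_nat_0_less_iff of_nat_less_iff pos_mod_bound)
    have z_pos: "0 < z"
      using zr r by (cases z) auto
    show "r \<in> (\<lambda>k. k\<^sup>2 mod p) ` {1..(p - 1) div 2}"
    proof (cases "z \<le> (p - 1) div 2")
      case True
      thus ?thesis using zr z_pos by (intro image_eqI[of _ _ z]) auto
    next
      case False
      \<comment> \<open>A root in the upper half is replaced by its negative
        \<open>p - z\<close>.\<close>
      have "int ((p - z)\<^sup>2 mod p) = (int p - int z)\<^sup>2 mod int p"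
        using z_less by (simp add: of_nat_mod of_nat_diff)
      also have "(int p - int z)\<^sup>2 = (int z)\<^sup>2 + int p * (int p - 2 * int z)"
        by (simp add: power2_eq_square algebra_simps)
      also have "\<dots> mod int p = int (z\<^sup>2 mod p)"
        by (simp add: of_nat_mod)
      finally have "(p - z)\<^sup>2 mod p = r"
        using zr by simp
      moreover have "p - z \<in> {1..(p - 1) div 2}"
        using False z_less odd_p by (auto elim!: oddE)
      ultimately show ?thesis by blast
    qed
  qed
  ultimately show ?thesis
    by (simp add: bij_betw_def)
qed

lemma card_S_1: "card (S 1) = (p - 1) div 2"
  using bij_betw_same_card[OF squares_bij] by simp

lemma G_eq_H: "G p x = H 1 x"
proof -
  have "exp (2 * of_real pi * \<i> * of_nat (k ^ 2) / of_nat p) = \<xi> ^ (k\<^sup>2 mod p)" for k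
  proof -
    have "\<xi> ^ (k\<^sup>2) = cis (real (k\<^sup>2) * (2 * pi / real p))"
      by (simp add: \<xi>_def Complex.DeMoivre)
    also have "\<dots> = exp (2 * of_real pi * \<i> * of_nat (k ^ 2) / of_nat p)"
      unfolding cis_conv_exp by (rule arg_cong[where f = exp]) simp
    finally show ?thesis
      by (simp add: xi_power_mod)
  qed
  hence "G p x = (\<Prod>k = 1..(p - 1) div 2. x - \<xi> ^ (k\<^sup>2 mod p))"
    by (simp only: G_def)
  also have "\<dots> = H 1 x"
    unfolding H_def by (rule prod.reindex_bij_betw[OF squares_bij])
  finally show ?thesis .
qed

lemma xi_power_bij: "bij_betw (\<lambda>r. \<xi> ^ r) {..<p} {z. z ^ p = 1}"
proof -
  have roots: "(\<lambda>r. \<xi> ^ r) = (\<lambda>r. cis (2 * pi * real r / real p))"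
    by (auto simp: \<xi>_def Complex.DeMoivre algebra_simps)
  show ?thesis
    unfolding roots by (rule Complex.bij_betw_roots_unity[OF p_pos])
qed

text \<open>Both sides are monic of degree \<open>p\<close> in \<open>x\<close> and vanish at the
  \<open>p\<close> roots of unity; with equal leading coefficients, agreement at \<open>p\<close>
  points suffices.\<close>

lemma prod_xi_minus: "(\<Prod>r<p. x - \<xi> ^ r) = x ^ p - 1"
proof -
  have "(\<Prod>r<p. [:- (\<xi> ^ r), 1:]) = Polynomial.monom 1 p - 1"
  proof (rule poly_eqI_degree_lead_coeff[where n = p and A = "{z. z ^ p = 1}"])
    have deg: "degree (\<Prod>r<p. [:- (\<xi> ^ r), 1:]) = p"
      by (subst degree_prod_eq_sum_degree) auto
    thus "degree (\<Prod>r<p. [:- (\<xi> ^ r), 1:]) \<le> p"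
      by simp
    show "degree (Polynomial.monom (1 :: complex) p - 1) \<le> p"
      by (intro degree_diff_le) (auto simp: degree_monom_eq)
    have "lead_coeff (\<Prod>r<p. [:- (\<xi> ^ r), 1:]) = 1"
      by (simp add: lead_coeff_prod)
    thus "Polynomial.coeff (\<Prod>r<p. [:- (\<xi> ^ r), 1:]) p = Polynomial.coeff (Polynomial.monom 1 p - 1) p"
      using deg p_pos by (simp add: coeff_1)
    show "p \<le> card {z :: complex. z ^ p = 1}"
      using card_roots_unity_eq[OF p_pos] by simp
    fix z :: complex assume z: "z \<in> {z. z ^ p = 1}"
    then obtain r where "r < p" "z = \<xi> ^ r"
      using xi_power_bij by (force simp: bij_betw_def)
    hence "poly (\<Prod>r<p. [:- (\<xi> ^ r), 1:]) z = 0"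
      by (auto simp: poly_prod)
    thus "poly (\<Prod>r<p. [:- (\<xi> ^ r), 1:]) z = poly (Polynomial.monom 1 p - 1) z"
      using z by (simp add: poly_monom)
  qed
  hence "poly (\<Prod>r<p. [:- (\<xi> ^ r), 1:]) x = poly (Polynomial.monom 1 p - 1) x"
    by simp
  thus ?thesis
    by (simp add: poly_prod poly_monom)
qed

lemma H_mult_H: "H 1 x * H (- 1) x * (x - 1) = x ^ p - 1"
proof -
  have "Legendre (int r) (int p) = 1 \<or> Legendre (int r) (int p) = - 1" if "r \<in> {1..<p}" for r
  proof -
    have "\<not> p dvd r"
      using that by (auto simp: nat_dvd_not_less)
    thus ?thesis
      using Legendre_eq_0_iff[of r] by (auto simp: Legendre_def split: if_splits)
  qed
  hence "{1..<p} = S 1 \<union> S (- 1)"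
    unfolding S_def by blast
  moreover have "{..<p} = insert 0 {1..<p}"
    using p_pos by auto
  ultimately have S: "{..<p} = insert 0 (S 1 \<union> S (- 1))"
    by (simp only:)
  have "S 1 \<inter> S (- 1) = {}" "0 \<notin> S 1 \<union> S (- 1)"
    by (auto simp: S_def)
  hence "(\<Prod>r<p. x - \<xi> ^ r) = (x - 1) * (H 1 x * H (- 1) x)"
    unfolding S by (simp add: H_def prod.union_disjoint)
  thus ?thesis
    by (simp add: prod_xi_minus mult.commute)
qed

section \<open>Doubling and quintupling identities\<close>

text \<open>Each residue contributes \<open>(x - \<xi> ^ r) * (- x - \<xi> ^ r)\<close>, which is
  minus \<open>x\<^sup>2 - \<xi> ^ (2 * r)\<close>. The signs cancel because the number of residues
  is even, and doubling turns residues into nonresidues.\<close>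

lemma H_double:
  assumes "Legendre 2 (int p) = - 1" "p mod 4 = 1"
  shows "H 1 x * H 1 (- x) = H (- 1) (x\<^sup>2)"
proof -
  have "even (card (S 1))"
    unfolding card_S_1 using assms(2) by presburger
  hence "H 1 x * H 1 (- x) = (\<Prod>r\<in>S 1. - 1) * (\<Prod>r\<in>S 1. (x - \<xi> ^ r) * (- x - \<xi> ^ r))"
    by (simp add: H_def prod.distrib)
  also have "\<dots> = (\<Prod>r\<in>S 1. x\<^sup>2 - \<xi> ^ (2 * r))"
    unfolding prod.distrib[symmetric]
    by (intro prod.cong refl) (simp add: power_mult power2_eq_square mult_2 power_add algebra_simps)
  also have "\<dots> = H (- 1) (x\<^sup>2)"
    using prod_S_mult[of 2 "- 1" "\<lambda>y. x\<^sup>2 - y" 1] assms(1) by (simp add: H_def)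
  finally show ?thesis .
qed

text \<open>Factor \<open>1 - y ^ 5\<close> over the fifth roots of unity at
  \<open>y = \<xi> ^ r\<close> and multiply over the residues. As 5 is a residue, \<open>r\<close>
  and \<open>5 * r\<close> run through the same class, so the left side is again
  \<open>H 1 1\<close>.\<close>

lemma H_quintuple:
  assumes "Legendre 5 (int p) = 1" "w ^ 5 = 1" "w \<noteq> 1"
  shows "H 1 1 = H 1 1 * H 1 w * H 1 (w ^ 2) * H 1 (w ^ 3) * H 1 (w ^ 4)"
proof -
  have "(w - 1) * (1 + w + w ^ 2 + w ^ 3 + w ^ 4) = w ^ 5 - 1"
    by (simp add: power_numeral_reduce algebra_simps)
  hence w: "1 + w + w ^ 2 + w ^ 3 + w ^ 4 = 0"
    using assms by simp
  have "1 - y ^ 5 = (1 - y) * (w - y) * (w ^ 2 - y) * (w ^ 3 - y) * (w ^ 4 - y)" for y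
  proof -
    \<comment> \<open>The two quadratic periods of the fifth roots of unity; their sum and product
      split \<open>1 + y + y ^ 2 + y ^ 3 + y ^ 4\<close> into two quadratics.\<close>
    define a b where "a = w + w ^ 4" and "b = w ^ 2 + w ^ 3"
    have ab: "a + b = - 1" "a * b = - 1"
    proof -
      have "w ^ 6 = w" "w ^ 7 = w ^ 2"
        using assms(2) by (simp_all add: power_numeral_reduce)
      moreover have "a * b = w ^ 3 + w ^ 4 + w ^ 6 + w ^ 7"
        unfolding a_def b_def by (simp add: power_numeral_reduce algebra_simps)
      ultimately show "a + b = - 1" "a * b = - 1"
        using w unfolding a_def b_def by (simp_all add: eq_neg_iff_add_eq_0 algebra_simps)
    qed
    have pairs: "(w - y) * (w ^ 4 - y) = 1 - a * y + y ^ 2" "(w ^ 2 - y) * (w ^ 3 - y) = 1 - b * y + y ^ 2"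
      using assms(2) unfolding a_def b_def by (simp_all add: power_numeral_reduce algebra_simps)
    have quad: "(1 - a * y + y ^ 2) * (1 - b * y + y ^ 2) = 1 + y + y ^ 2 + y ^ 3 + y ^ 4"
    proof -
      have "(1 - a * y + y ^ 2) * (1 - b * y + y ^ 2)
          = 1 - (a + b) * y + (2 + a * b) * y ^ 2 - (a + b) * y ^ 3 + y ^ 4"
        by (simp add: power_numeral_reduce ring_distribs)
      thus ?thesis
        unfolding ab by simp
    qed
    have "(1 - y) * (w - y) * (w ^ 2 - y) * (w ^ 3 - y) * (w ^ 4 - y)
        = (1 - y) * (((w - y) * (w ^ 4 - y)) * ((w ^ 2 - y) * (w ^ 3 - y)))"
      by (simp only: mult_ac)
    also have "\<dots> = (1 - y) * (1 + y + y ^ 2 + y ^ 3 + y ^ 4)"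
      unfolding pairs quad ..
    also have "\<dots> = 1 - y ^ 5"
      by (simp add: power_numeral_reduce ring_distribs)
    finally show ?thesis ..
  qed
  moreover have "H 1 1 = (\<Prod>r\<in>S 1. 1 - (\<xi> ^ r) ^ 5)"
    using prod_S_mult[of 5 1 "\<lambda>y. 1 - y" 1] assms(1)
    by (simp add: H_def mult.commute flip: power_mult)
  ultimately show ?thesis
    by (simp add: H_def prod.distrib)
qed

section \<open>Pairing \<open>r\<close> with \<open>p - r\<close>\<close>

definition S_half :: "nat set" where
  "S_half = {r \<in> S 1. 2 * r < p}"

lemma S_1_reflect:
  assumes "p mod 4 = 1" "r \<in> S 1"
  shows "p - r \<in> S 1"
proof -
  have r: "1 \<le> r" "r < p" "Legendre (int r) (int p) = 1"
    using assms by (auto simp: S_def)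
  have "[int (p - r) = - 1 * int r] (mod int p)"
    using r by (simp add: cong_iff_dvd_diff of_nat_diff)
  hence "Legendre (int (p - r)) (int p) = 1"
    using Legendre_cong Legendre_mult[of "- 1" "int r"] Legendre_minus_one assms r by simp
  thus ?thesis
    using r by (auto simp: S_def)
qed

lemma S_half_split:
  assumes "p mod 4 = 1"
  shows "S 1 = S_half \<union> (\<lambda>r. p - r) ` S_half" "S_half \<inter> (\<lambda>r. p - r) ` S_half = {}"
    "inj_on (\<lambda>r. p - r) S_half"
proof -
  have "r \<in> (\<lambda>r. p - r) ` S_half" if r: "r \<in> S 1" "r \<notin> S_half" for r
  proof (rule image_eqI)
    show "r = p - (p - r)"
      using r by (auto simp: S_def)
    have "p < 2 * r"
      using r odd_p by (cases "p = 2 * r") (auto simp: S_half_def)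
    moreover have "r < p"
      using r by (simp add: S_def)
    ultimately have "2 * (p - r) < p"
      by linarith
    thus "p - r \<in> S_half"
      using S_1_reflect[OF assms r(1)] by (simp add: S_half_def)
  qed
  thus "S 1 = S_half \<union> (\<lambda>r. p - r) ` S_half"
    using S_1_reflect[OF assms] by (auto simp: S_half_def)
  show "S_half \<inter> (\<lambda>r. p - r) ` S_half = {}"
    by (auto simp: S_half_def)
  show "inj_on (\<lambda>r. p - r) S_half"
    by (rule inj_onI) (auto simp: S_half_def)
qed

lemma finite_S_half [simp]: "finite S_half"
  by (simp add: S_half_def)

lemma card_S_half:
  assumes "p mod 4 = 1"
  shows "card S_half = (p - 1) div 4"
proof -
  have "card (S 1) = card S_half + card ((\<lambda>r. p - r) ` S_half)"
    using S_half_split[OF assms] by (metis card_Un_disjoint finite_S_half finite_imageI)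
  also have "\<dots> = 2 * card S_half"
    using S_half_split(3)[OF assms] by (simp add: card_image)
  finally show ?thesis
    by (simp add: card_S_1)
qed

text \<open>The roots \<open>\<xi> ^ r\<close> and \<open>\<xi> ^ (p - r)\<close> are conjugate with
  product 1, so each pair gives a palindromic quadratic with coefficient minus twice a
  cosine.\<close>

lemma H_half:
  assumes "p mod 4 = 1"
  shows "H 1 x = (\<Prod>r\<in>S_half. x\<^sup>2 + 1 - 2 * of_real (cos (2 * pi * r / p)) * x)"
proof -
  have "H 1 x = (\<Prod>r\<in>S_half. x - \<xi> ^ r) * (\<Prod>r\<in>(\<lambda>r. p - r) ` S_half. x - \<xi> ^ r)"
    using S_half_split[OF assms] unfolding H_def
    by (metis prod.union_disjoint finite_S_half finite_imageI)
  also have "\<dots> = (\<Prod>r\<in>S_half. (x - \<xi> ^ r) * (x - \<xi> ^ (p - r)))"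
    using S_half_split(3)[OF assms] by (simp add: prod.reindex prod.distrib)
  also have "\<dots> = (\<Prod>r\<in>S_half. x\<^sup>2 + 1 - 2 * of_real (cos (2 * pi * r / p)) * x)"
  proof (intro prod.cong refl)
    fix r assume "r \<in> S_half"
    hence rp: "\<xi> ^ r * \<xi> ^ (p - r) = 1"
      using xi_power_p by (simp add: S_half_def flip: power_add)
    have r: "\<xi> ^ r = cis (2 * pi * r / p)"
      by (simp add: \<xi>_def Complex.DeMoivre algebra_simps)
    have "\<xi> ^ (p - r) = inverse (\<xi> ^ r)"
      using rp by (metis inverse_unique)
    hence "\<xi> ^ (p - r) = cis (- (2 * pi * r / p))"
      by (simp add: r)
    hence sum: "\<xi> ^ r + \<xi> ^ (p - r) = 2 * of_real (cos (2 * pi * r / p))"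
      unfolding r by (simp add: complex_eq_iff)
    have "(x - \<xi> ^ r) * (x - \<xi> ^ (p - r)) = x\<^sup>2 + \<xi> ^ r * \<xi> ^ (p - r) - (\<xi> ^ r + \<xi> ^ (p - r)) * x"
      by (simp add: power2_eq_square algebra_simps)
    thus "(x - \<xi> ^ r) * (x - \<xi> ^ (p - r)) = x\<^sup>2 + 1 - 2 * of_real (cos (2 * pi * r / p)) * x"
      by (simp only: rp sum)
  qed
  finally show ?thesis .
qed

text \<open>Every quadratic factor is palindromic, so passing from \<open>x\<close> to its inverse
  \<open>y\<close> extracts \<open>y\<^sup>2\<close> from each of the \<open>(p - 1) div 4\<close>
  factors.\<close>

lemma H_reciprocal:
  assumes "p mod 4 = 1" "x * y = 1"
  shows "H 1 y = y ^ ((p - 1) div 2) * H 1 x"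
proof -
  have "(p - 1) div 2 = 2 * card S_half"
    using assms(1) card_S_half by presburger
  hence "y ^ ((p - 1) div 2) = (\<Prod>r\<in>S_half. y\<^sup>2)"
    by (simp add: power_mult)
  moreover have "y\<^sup>2 + 1 - c * y = y\<^sup>2 * (x\<^sup>2 + 1 - c * x)" for c
  proof -
    have "y\<^sup>2 * (x\<^sup>2 + 1 - c * x) = (x * y) * (x * y) + y\<^sup>2 - c * y * (x * y)"
      by (simp add: power2_eq_square algebra_simps)
    thus ?thesis
      unfolding assms(2) by simp
  qed
  ultimately show ?thesis
    unfolding H_half[OF assms(1)] by (simp add: prod.distrib)
qed

section \<open>The symbols of 2 and 5\<close>

text \<open>Gauss's lemma: among \<open>2, 4, \<dots>, p - 1\<close> exactly \<open>(p - 1) / 4\<close>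
  numbers exceed \<open>p / 2\<close>.\<close>
lemma Legendre_2:
  assumes "p mod 8 = 5"
  shows "Legendre 2 (int p) = - 1"
proof -
  interpret GAUSS p 2
    using prime_p p_gt_2 by unfold_locales (auto simp: cong_0_iff dest: zdvd_imp_le)
  define m where "m = (int p - 1) div 4"
  have m: "int p = 4 * m + 1" "odd m"
    using assms unfolding m_def by presburger+
  \<comment> \<open>For \<open>x\<close> up to \<open>2 * m\<close> the double stays below
    \<open>p\<close>, so nothing is reduced; it exceeds \<open>2 * m\<close>, the half point,
    exactly when \<open>m < x\<close>.\<close>
  have "E = (\<lambda>x. 2 * x) ` {m<..2 * m}"
  proof -
    have A: "A = {0<..2 * m}"
      unfolding A_def using m(1) by auto
    have "C = (\<lambda>x. 2 * x) ` A"
      unfolding C_def B_def image_image using m(1)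
      by (intro image_cong refl) (auto simp: A)
    thus ?thesis
      unfolding E_def using m(1) by (auto simp: A)
  qed
  hence "card E = nat m"
    by (simp add: card_image inj_on_def)
  thus ?thesis
    using gauss_lemma m p_pos by (simp add: even_nat_iff)
qed

text \<open>The reciprocity sign is trivial because (5 - 1)/2 is even, and the nonzero squares
  modulo 5 are 1 and 4.\<close>

lemma Legendre_5:
  assumes "p mod 5 = 1 \<or> p mod 5 = 4" "5 < p"
  shows "Legendre 5 (int p) = 1"
proof -
  have "prime (5 :: nat)"
    by simp
  from Quadratic_Reciprocity[OF this _ prime_p p_gt_2] assms(2)
  have "Legendre 5 (int p) * Legendre (int p) 5 = 1"
    by simp
  moreover have "Legendre (int p) 5 = 1"
  proof -
    have "[1\<^sup>2 = int p] (mod 5) \<or> [2\<^sup>2 = int p] (mod 5)"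
      using assms(1) unfolding cong_def by (simp; presburger)
    hence "QuadRes 5 (int p)"
      unfolding QuadRes_def by blast
    moreover have "\<not> [int p = 0] (mod 5)"
      using assms(1) unfolding cong_def by presburger
    ultimately show ?thesis
      by (simp add: Legendre_def)
  qed
  ultimately show ?thesis
    by simp
qed

section \<open>Values at primitive tenth roots up to sign\<close>

lemma H_1_1_nonzero: "H 1 1 \<noteq> 0"
proof
  assume "H 1 1 = 0"
  then obtain r where r: "r \<in> S 1" "\<xi> ^ r = 1"
    by (auto simp: H_def)
  have "r = 0"
    by (rule inj_onD[OF bij_betw_imp_inj_on[OF xi_power_bij]]) (use r p_pos in \<open>auto simp: S_def\<close>)
  thus False
    using r by (simp add: S_def)
qed

text \<open>Doubling is applied at \<open>z\<close> and \<open>z ^ 3\<close>, whose negatives are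
  \<open>z ^ 6\<close> and \<open>z ^ 8\<close>; quintupling is applied to the primitive fifth root
  \<open>z ^ 2\<close>, and \<open>H 1 1\<close> cancels.\<close>

lemma H_tenth_root_cases:
  assumes "p mod 8 = 5" "p mod 5 = 1 \<or> p mod 5 = 4" "5 < p" "z ^ 5 = - 1" "z\<^sup>2 \<noteq> 1"
  defines "A \<equiv> H 1 (z ^ 2)" and "B \<equiv> H 1 (z ^ 6)"
  shows "H 1 z * B = H (- 1) (z ^ 2)" "H 1 (z ^ 3) * H 1 (z ^ 8) = H (- 1) (z ^ 6)"
    "A * H 1 (z ^ 4) * B * H 1 (z ^ 8) = 1"
proof -
  have p4: "p mod 4 = 1"
    using assms(1) by presburger
  note double = H_double[OF Legendre_2[OF assms(1)] p4]
  have z: "z ^ 6 = - z" "z ^ 8 = - (z ^ 3)" "z ^ 10 = 1"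
    using power_add[of z 5 1] power_add[of z 5 3] power_add[of z 5 5] assms(4) by simp_all
  show "H 1 z * B = H (- 1) (z ^ 2)"
    using double[of z] by (simp add: B_def z)
  show "H 1 (z ^ 3) * H 1 (z ^ 8) = H (- 1) (z ^ 6)"
    using double[of "z ^ 3"] by (simp add: z(2) flip: power_mult)
  show "A * H 1 (z ^ 4) * B * H 1 (z ^ 8) = 1"
    using H_quintuple[of "z ^ 2"] Legendre_5[OF assms(2,3)] assms(5) H_1_1_nonzero z(3)
    by (simp add: A_def B_def mult.assoc flip: power_mult)
qed

text \<open>Since \<open>p\<close> is 1 modulo 10, \<open>x ^ p = x\<close> at \<open>z ^ 2\<close>
  and \<open>z ^ 6\<close>, so \<open>H 1\<close> and \<open>H (- 1)\<close> are inverse there.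
  Since 5 divides \<open>(p - 1) div 2\<close>, \<open>H 1\<close> agrees at inverse fifth roots.
  Hence \<open>H 1 z\<close> and \<open>H 1 (z ^ 3)\<close> are both inverse to
  \<open>A * B\<close>, whose square is 1.\<close>

lemma H_tenth_root_21:
  assumes "p mod 40 = 21" "z ^ 5 = - 1" "z\<^sup>2 \<noteq> 1"
  shows "H 1 (z ^ 3) = H 1 z" "(H 1 z)\<^sup>2 = 1"
proof -
  define A B where "A = H 1 (z ^ 2)" and "B = H 1 (z ^ 6)"
  obtain q where q: "p = 40 * q + 21"
    using assms(1) mult_div_mod_eq[of 40 p] by metis
  define m where "m = 4 * q + 2"
  have m: "p = 10 * m + 1" "(p - 1) div 2 = 5 * m"
    by (simp_all add: m_def q)
  have p: "p mod 8 = 5" "p mod 4 = 1" "p mod 5 = 1 \<or> p mod 5 = 4" "5 < p"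
    unfolding q by presburger+
  have z: "z ^ 10 = 1" "z ^ 6 \<noteq> 1"
    using tenth_root_sixth[OF assms(2,3)] tenth_root_power[OF assms(2), of 1 0] by simp_all
  note cases = H_tenth_root_cases[OF p(1,3,4) assms(2,3), folded A_def B_def]
  have pow: "(z ^ 2) ^ p = z ^ 2" "(z ^ 6) ^ p = z ^ 6"
    by (rule tenth_root_power_power[OF assms(2), where m = "2 * m"], simp add: m(1),
        rule tenth_root_power_power[OF assms(2), where m = "6 * m"], simp add: m(1))
  have recip: "(z ^ 8) ^ ((p - 1) div 2) = z ^ 0" "(z ^ 4) ^ ((p - 1) div 2) = z ^ 0"
    by (rule tenth_root_power_power[OF assms(2), where m = "4 * m"], subst m(2), simp,
        rule tenth_root_power_power[OF assms(2), where m = "2 * m"], subst m(2), simp)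
  have AB: "A * H (- 1) (z ^ 2) = 1" "B * H (- 1) (z ^ 6) = 1"
    using H_mult_H[of "z ^ 2"] H_mult_H[of "z ^ 6"] pow z(2) assms(3) by (simp_all add: A_def B_def)
  have H84: "H 1 (z ^ 8) = A" "H 1 (z ^ 4) = B"
    using H_reciprocal[OF p(2), of "z ^ 2" "z ^ 8"] H_reciprocal[OF p(2), of "z ^ 6" "z ^ 4"] recip z(1)
    by (simp_all add: A_def B_def flip: power_add)
  have zAB: "H 1 z * (A * B) = 1"
    using cases(1) AB(1) by (simp add: mult_ac)
  have "H 1 (z ^ 3) * (A * B) = B * (H 1 (z ^ 3) * H 1 (z ^ 8))"
    unfolding H84 by (simp only: mult_ac)
  hence z3AB: "H 1 (z ^ 3) * (A * B) = 1"
    unfolding cases(2) AB(2) .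
  have AB_sq: "(A * B)\<^sup>2 = 1"
    using cases(3) unfolding H84 by (simp add: mult_ac power2_eq_square)
  have "A * B \<noteq> 0"
    using zAB by auto
  thus "H 1 (z ^ 3) = H 1 z"
    using zAB z3AB by (metis mult_right_cancel)
  have "(H 1 z)\<^sup>2 * (A * B)\<^sup>2 = 1"
    using arg_cong[OF zAB, of "\<lambda>x. x\<^sup>2"] by (simp only: power_mult_distrib power_one)
  thus "(H 1 z)\<^sup>2 = 1"
    using AB_sq by simp
qed

text \<open>The scheme of the case 21 with extra powers of \<open>z\<close>: now \<open>p\<close> is
  9 modulo 10, so \<open>x ^ p\<close> is the inverse of \<open>x\<close> at a fifth root, and
  \<open>(p - 1) div 2\<close> is 4 modulo 5, so reciprocity from \<open>x\<close> to its inverse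
  contributes a factor \<open>x\<close>.\<close>

lemma H_tenth_root_29:
  assumes "p mod 40 = 29" "z ^ 5 = - 1" "z\<^sup>2 \<noteq> 1"
  shows "H 1 (z ^ 3) = z ^ 4 * H 1 z" "(H 1 z)\<^sup>2 = z ^ 4"
proof -
  define A B where "A = H 1 (z ^ 2)" and "B = H 1 (z ^ 6)"
  obtain q where q: "p = 40 * q + 29"
    using assms(1) mult_div_mod_eq[of 40 p] by metis
  define m where "m = 4 * q + 2"
  have m: "p = 10 * m + 9" "(p - 1) div 2 = 5 * m + 4"
    by (simp_all add: m_def q)
  have p: "p mod 8 = 5" "p mod 4 = 1" "p mod 5 = 1 \<or> p mod 5 = 4" "5 < p"
    unfolding q by presburger+
  have z: "z ^ 10 = 1" "z ^ 6 \<noteq> 1"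
    using tenth_root_sixth[OF assms(2,3)] tenth_root_power[OF assms(2), of 1 0] by simp_all
  note cases = H_tenth_root_cases[OF p(1,3,4) assms(2,3), folded A_def B_def]
  have z_mod: "z ^ (10 + n) = z ^ n" for n
    using tenth_root_power[OF assms(2), of 1 n] by simp
  have pow: "(z ^ 2) ^ p = z ^ 8" "(z ^ 6) ^ p = z ^ 4"
    by (rule tenth_root_power_power[OF assms(2), where m = "2 * m + 1"], simp add: m(1),
        rule tenth_root_power_power[OF assms(2), where m = "6 * m + 5"], simp add: m(1))
  have recip: "(z ^ 8) ^ ((p - 1) div 2) = z ^ 2" "(z ^ 4) ^ ((p - 1) div 2) = z ^ 6"
    by (rule tenth_root_power_power[OF assms(2), where m = "4 * m + 3"], subst m(2), simp,
        rule tenth_root_power_power[OF assms(2), where m = "2 * m + 1"], subst m(2), simp)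
  have AB: "A * H (- 1) (z ^ 2) = - (z ^ 8)" "B * H (- 1) (z ^ 6) = - (z ^ 4)"
  proof -
    \<comment> \<open>The right side is \<open>z ^ 8 - 1\<close>, because \<open>z ^ 10 = 1\<close>;
      likewise below with \<open>z ^ 4 - 1\<close>.\<close>
    have "A * H (- 1) (z ^ 2) * (z ^ 2 - 1) = - (z ^ 8) * (z ^ 2 - 1)"
      using H_mult_H[of "z ^ 2"] pow(1) z(1) by (simp add: A_def algebra_simps flip: power_add)
    thus "A * H (- 1) (z ^ 2) = - (z ^ 8)"
      using assms(3) by (metis mult_right_cancel right_minus_eq)
    have "B * H (- 1) (z ^ 6) * (z ^ 6 - 1) = - (z ^ 4) * (z ^ 6 - 1)"
      using H_mult_H[of "z ^ 6"] pow(2) z(1) by (simp add: B_def algebra_simps flip: power_add)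
    thus "B * H (- 1) (z ^ 6) = - (z ^ 4)"
      using z(2) by (metis mult_right_cancel right_minus_eq)
  qed
  have H84: "H 1 (z ^ 8) = z ^ 2 * A" "H 1 (z ^ 4) = z ^ 6 * B"
    using H_reciprocal[OF p(2), of "z ^ 2" "z ^ 8"] H_reciprocal[OF p(2), of "z ^ 6" "z ^ 4"] recip z(1)
    by (simp_all add: A_def B_def flip: power_add)
  have zAB: "H 1 z * (A * B) = - (z ^ 8)"
    using cases(1) AB(1) by (simp add: mult_ac)
  have "z ^ 2 * (H 1 (z ^ 3) * (A * B)) = B * (H 1 (z ^ 3) * H 1 (z ^ 8))"
    unfolding H84 by (simp only: mult_ac)
  hence "z ^ 2 * (H 1 (z ^ 3) * (A * B)) = - (z ^ 4)"
    unfolding cases(2) AB(2) .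
  \<comment> \<open>\<open>z ^ 8\<close> is the inverse of \<open>z ^ 2\<close>, which clears the
    reciprocity factor.\<close>
  hence "z ^ 8 * (z ^ 2 * (H 1 (z ^ 3) * (A * B))) = z ^ 8 * - (z ^ 4)"
    by (rule arg_cong)
  hence z3AB: "H 1 (z ^ 3) * (A * B) = - (z ^ 2)"
    using z(1) z_mod[of 2] by (simp flip: mult.assoc power_add)
  have "z \<noteq> 0"
    using assms(2) by auto
  hence "A * B \<noteq> 0"
    using zAB by auto
  moreover have "z ^ 4 * (H 1 z * (A * B)) = - (z ^ 2)"
    unfolding zAB using z_mod[of 2] by (simp flip: power_add)
  hence "z ^ 4 * H 1 z * (A * B) = H 1 (z ^ 3) * (A * B)"
    unfolding z3AB by (simp only: mult.assoc)
  ultimately show "H 1 (z ^ 3) = z ^ 4 * H 1 z"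
    by (metis mult_right_cancel)
  have "z ^ 8 * (A * B)\<^sup>2 = 1"
  proof -
    have "z ^ 8 * (A * B)\<^sup>2 = A * (z ^ 6 * B) * B * (z ^ 2 * A)"
      by (simp add: power2_eq_square power_numeral_reduce mult_ac)
    thus ?thesis
      using cases(3) H84 by simp
  qed
  moreover have "(H 1 z)\<^sup>2 * (A * B)\<^sup>2 = z ^ 6"
    using arg_cong[OF zAB, of "\<lambda>x. x\<^sup>2"] z_mod[of 6] by (simp add: power_mult_distrib flip: power_mult)
  hence "(H 1 z)\<^sup>2 * (z ^ 8 * (A * B)\<^sup>2) = z ^ 14"
    by (simp add: mult.left_commute flip: power_add)
  ultimately show "(H 1 z)\<^sup>2 = z ^ 4"
    using z_mod[of 4] by simp
qed

section \<open>The sign at \<open>cis (pi / 5)\<close>\<close>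

text \<open>On the unit circle each palindromic quadratic is the point times a real number; here
  that number is negative exactly when the angle of \<open>\<xi> ^ r\<close> is below
  \<open>pi / 5\<close>. Only the sign of \<open>P\<close> is recorded, since its square follows
  from the known square of \<open>H 1\<close>.\<close>

lemma H_cis_36:
  assumes "p mod 4 = 1"
  obtains P where "H 1 (cis (pi / 5)) = cis (pi / 5) ^ ((p - 1) div 4) * of_real P"
    "sgn P = (- 1) ^ card {r \<in> S 1. 10 * r < p}"
proof
  define c where "c = cis (pi / 5)"
  define d where "d r = 2 * (cos (pi / 5) - cos (2 * pi * real r / real p))" for r
  have sum: "c\<^sup>2 + 1 = 2 * of_real (cos (pi / 5)) * c"
  proof -
    have "c + cis (- (pi / 5)) = 2 * of_real (cos (pi / 5))"
      by (simp add: c_def complex_eq_iff)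
    moreover have "c * cis (- (pi / 5)) = 1"
      by (simp add: c_def cis_mult)
    hence "c\<^sup>2 + 1 = (c + cis (- (pi / 5))) * c"
      by (simp add: power2_eq_square algebra_simps)
    ultimately show ?thesis
      by simp
  qed
  have "H 1 c = (\<Prod>r\<in>S_half. c * of_real (d r))"
    unfolding H_half[OF assms] sum d_def by (simp add: algebra_simps)
  thus "H 1 (cis (pi / 5)) = cis (pi / 5) ^ ((p - 1) div 4) * of_real (\<Prod>r\<in>S_half. d r)"
    by (simp add: c_def prod.distrib card_S_half[OF assms])
  have sgn_d: "sgn (d r) = (if 10 * r < p then - 1 else 1)" if r: "r \<in> S_half" for r
  proof -
    have bounds: "0 \<le> 2 * pi * real r / real p" "2 * pi * real r / real p \<le> pi"
      using r p_pos by (auto simp: S_half_def field_simps simp flip: of_nat_mult intro!: mult_right_mono)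
    have "10 * r \<noteq> p"
      using odd_p by auto
    consider "10 * r < p" | "p < 10 * r"
      using \<open>10 * r \<noteq> p\<close> by linarith
    thus ?thesis
    proof cases
      case 1
      hence "real (10 * r) < real p"
        by (simp only: of_nat_less_iff)
      hence "2 * pi * real r / real p < pi / 5"
        using p_pos by (simp add: field_simps)
      hence "cos (pi / 5) < cos (2 * pi * real r / real p)"
        using bounds by (intro cos_monotone_0_pi) auto
      thus ?thesis
        using 1 by (simp add: d_def)
    next
      case 2
      hence "real p < real (10 * r)"
        by (simp only: of_nat_less_iff)
      hence "pi / 5 < 2 * pi * real r / real p"
        using p_pos by (simp add: field_simps)
      hence "cos (2 * pi * real r / real p) < cos (pi / 5)"
        using bounds by (intro cos_monotone_0_pi) auto
      thus ?thesis
        using 2 by (simp add: d_def)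
    qed
  qed
  have "sgn (\<Prod>r\<in>S_half. d r) = (\<Prod>r\<in>S_half. if 10 * r < p then - 1 else 1)"
  proof -
    have "sgn (\<Prod>r\<in>A. d r) = (\<Prod>r\<in>A. sgn (d r))" for A :: "nat set"
      by (induction A rule: infinite_finite_induct) (simp_all add: sgn_mult)
    thus ?thesis
      by (simp add: sgn_d)
  qed
  also have "\<dots> = (- 1) ^ card {r \<in> S_half. 10 * r < p}"
    by (simp add: prod.If_cases Int_def)
  also have "{r \<in> S_half. 10 * r < p} = {r \<in> S 1. 10 * r < p}"
    by (auto simp: S_half_def)
  finally show "sgn (\<Prod>r\<in>S_half. d r) = (- 1) ^ card {r \<in> S 1. 10 * r < p}" .
qed

text \<open>Converts the residues below \<open>p / 10\<close> into the nonresidues counted in the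
  theorem. Among the even number \<open>K\<close> of indices both kinds have the same parity; the
  last index \<open>Suc K\<close> lies beyond \<open>p / 10\<close> and, being a nonresidue, adds
  one minus sign.\<close>

lemma card_nonresidues:
  assumes "even K" "10 * K < p" "p < 10 * Suc K" "Legendre (int (Suc K)) (int p) = - 1"
  shows "(- 1 :: 'a :: ring_1) ^ card {k. 1 \<le> k \<and> k \<le> Suc K \<and> Legendre (int k) (int p) = - 1}
    = - ((- 1) ^ card {r \<in> S 1. 10 * r < p})"
proof -
  define N where "N = {k \<in> {1..K}. Legendre (int k) (int p) = - 1}"
  define R where "R = {k \<in> {1..K}. Legendre (int k) (int p) = 1}"
  have "Legendre (int k) (int p) = 1 \<or> Legendre (int k) (int p) = - 1" if "k \<in> {1..K}" for k
  proof -
    have "\<not> p dvd k"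
      using that assms(2) by (auto dest: dvd_imp_le)
    thus ?thesis
      using Legendre_eq_0_iff[of k] by (auto simp: Legendre_def split: if_splits)
  qed
  hence "{1..K} = N \<union> R"
    unfolding N_def R_def by blast
  moreover have "N \<inter> R = {}" "finite N" "finite R"
    by (auto simp: N_def R_def)
  ultimately have "card N + card R = K"
    by (metis card_Un_disjoint card_atLeastAtMost diff_Suc_1)
  hence "even (card N) \<longleftrightarrow> even (card R)"
    using assms(1) by (metis even_add)
  moreover have "{r \<in> S 1. 10 * r < p} = R"
    using assms(2,3) by (auto simp: S_def R_def)
  moreover have "{k. 1 \<le> k \<and> k \<le> Suc K \<and> Legendre (int k) (int p) = - 1} = insert (Suc K) N"
    using assms(4) by (auto simp: N_def le_Suc_eq)
  moreover have "Suc K \<notin> N"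
    by (simp add: N_def)
  ultimately show ?thesis
    using \<open>finite N\<close> by (simp add: minus_one_power_iff)
qed

text \<open>Modulo \<open>p\<close>, \<open>10 * k\<close> is the square 1 or 9, so \<open>k\<close>
  has the same symbol as 10, which is -1 because 2 is a nonresidue and 5 a residue.\<close>

lemma Legendre_tenth:
  assumes "p mod 8 = 5" "p mod 5 = 1 \<or> p mod 5 = 4" "5 < p" "10 * k = p + 1 \<or> 10 * k = p + 9"
  shows "Legendre (int k) (int p) = - 1"
proof -
  have "Legendre 3 (int p) \<noteq> 0"
    using assms(3) Legendre_eq_0_iff[of 3] by (auto dest: dvd_imp_le)
  hence "Legendre (3 * 3) (int p) = 1"
    unfolding Legendre_mult by (auto simp: Legendre_def split: if_splits)
  hence nine: "Legendre 9 (int p) = 1"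
    by simp
  have "QuadRes (int p) 1"
    unfolding QuadRes_def by (metis cong_refl power_one)
  hence one: "Legendre 1 (int p) = 1"
    using p_gt_2 by (simp add: Legendre_def cong_0_iff)
  have "[2 * 5 * int k = 1] (mod int p) \<or> [2 * 5 * int k = 9] (mod int p)"
  proof (cases "10 * k = p + 1")
    case True
    hence "2 * 5 * int k - 1 = int p"
      by simp
    thus ?thesis
      by (simp add: cong_iff_dvd_diff)
  next
    case False
    hence "2 * 5 * int k - 9 = int p"
      using assms(4) by simp
    thus ?thesis
      by (simp add: cong_iff_dvd_diff)
  qed
  hence "Legendre (2 * 5 * int k) (int p) = 1"
    using Legendre_cong one nine by metis
  thus ?thesis
    unfolding Legendre_mult using Legendre_2[OF assms(1)] Legendre_5[OF assms(2,3)] by simp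
qed

text \<open>The known square forces \<open>P\<^sup>2 = 1\<close>, so \<open>P\<close> equals its
  sign. The minus sign in \<open>- u\<close> cancels the one contributed by the nonresidue
  \<open>Suc K\<close>.\<close>

lemma tenth_root_sign:
  assumes "p mod 8 = 5" "p mod 5 = 1 \<or> p mod 5 = 4" "5 < p" "10 * Suc K = p + 1 \<or> 10 * Suc K = p + 9"
  assumes "cis (pi / 5) ^ ((p - 1) div 4) = - u" "(H 1 (cis (pi / 5)))\<^sup>2 = u\<^sup>2"
  shows "H 1 (cis (pi / 5))
    = (- 1) ^ card {k. 1 \<le> k \<and> k \<le> Suc K \<and> Legendre (int k) (int p) = - 1} * u"
proof -
  define n where "n = card {r \<in> S 1. 10 * r < p}"
  have "p mod 4 = 1"
    using assms(1) by presburger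
  then obtain P where P: "H 1 (cis (pi / 5)) = cis (pi / 5) ^ ((p - 1) div 4) * of_real P"
    "sgn P = (- 1) ^ n"
    unfolding n_def by (rule H_cis_36)
  have "u \<noteq> 0"
    using assms(5) cis_neq_zero by (metis neg_0_equal_iff_equal power_not_zero)
  have "u\<^sup>2 * of_real (P\<^sup>2) = u\<^sup>2 * 1"
    using assms(6) unfolding P(1) assms(5) by (simp add: power_mult_distrib)
  hence "(of_real (P\<^sup>2) :: complex) = of_real 1"
    using \<open>u \<noteq> 0\<close> by simp
  hence "P\<^sup>2 = 1"
    by (simp only: of_real_eq_iff)
  hence "P = sgn P"
    by (auto simp: power2_eq_1_iff)
  hence "P = (- 1) ^ n"
    using P(2) by simp
  moreover have "even K" "10 * K < p" "p < 10 * Suc K"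
  proof -
    obtain q where q: "p = 8 * q + 5"
      using assms(1) mult_div_mod_eq[of 8 p] by metis
    have "5 * Suc K = 2 * (2 * q + 1) + 1 \<or> 5 * Suc K = 2 * (2 * q + 3) + 1"
      using assms(4) by (auto simp: q)
    hence "odd (5 * Suc K)"
      by presburger
    thus "even K"
      by simp
    show "10 * K < p" "p < 10 * Suc K"
      using assms(3,4) by auto
  qed
  hence "(- 1 :: complex) ^ card {k. 1 \<le> k \<and> k \<le> Suc K \<and> Legendre (int k) (int p) = - 1}
      = - ((- 1) ^ n)"
    unfolding n_def using Legendre_tenth[OF assms(1-4)] by (intro card_nonresidues)
  ultimately show ?thesis
    unfolding P(1) assms(5) by simp
qed

end

theorem theorem1p2:
  fixes p :: nat and \<zeta> :: complex
  assumes "prime p" and "p > 5" and "primitive_root_of_unity 10 \<zeta>"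
  shows "([p = 21] (mod 40) \<longrightarrow>
            G p \<zeta> = (-1) ^ card {k::nat. 1 \<le> k \<and> k \<le> (p + 9) div 10 \<and> Legendre (int k) (int p) = -1}) \<and>
         ([p = 29] (mod 40) \<longrightarrow>
            G p \<zeta> = (-1) ^ card {k::nat. 1 \<le> k \<and> k \<le> (p + 1) div 10 \<and> Legendre (int k) (int p) = -1} * \<zeta> ^ 2)"
proof -
  interpret odd_prime p
    using assms by unfold_locales auto
  define c where "c = cis (pi / 5)"
  note c = cis_36[folded c_def]
  show ?thesis
  proof (intro conjI impI)
    assume "[p = 21] (mod 40)"
    hence p40: "p mod 40 = 21"
      by (simp add: cong_def)
    then obtain q where q: "p = 40 * q + 21"
      using mult_div_mod_eq[of 40 p] by metis
    have p: "p mod 8 = 5" "p mod 5 = 1 \<or> p mod 5 = 4"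
      unfolding q by presburger+
    \<comment> \<open>This determines \<open>u = 1\<close>; the last index is \<open>Suc K\<close>
      with \<open>K = 4 * q + 2\<close>.\<close>
    have "c ^ ((p - 1) div 4) = c ^ (10 * q + 5)"
      by (rule arg_cong[where f = "\<lambda>n. c ^ n"]) (simp add: q)
    hence "c ^ ((p - 1) div 4) = - 1"
      using tenth_root_power[OF c(1)] c(1) by simp
    moreover have "(H 1 c)\<^sup>2 = 1\<^sup>2"
      using H_tenth_root_21(2)[OF p40 c] by (simp flip: power_mult)
    moreover have "10 * Suc (4 * q + 2) = p + 1 \<or> 10 * Suc (4 * q + 2) = p + 9"
      by (simp add: q)
    moreover have Suc_div: "(p + 9) div 10 = Suc (4 * q + 2)"
      by (simp add: q)
    ultimately have Hc: "H 1 (cis (pi / 5))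
        = (- 1) ^ card {k. 1 \<le> k \<and> k \<le> (p + 9) div 10 \<and> Legendre (int k) (int p) = - 1} * 1"
      unfolding Suc_div c_def using p assms(2) by (intro tenth_root_sign)
    have "H 1 \<zeta> = (- 1) ^ card {k. 1 \<le> k \<and> k \<le> (p + 9) div 10 \<and> Legendre (int k) (int p) = - 1}"
    proof (rule primitive_tenth_root_induct[OF assms(3)])
      show "H 1 (cis (pi / 5))
          = (- 1) ^ card {k. 1 \<le> k \<and> k \<le> (p + 9) div 10 \<and> Legendre (int k) (int p) = - 1}"
        using Hc by (simp only: mult_1_right)
    next
      fix y s :: complex
      assume "y ^ 5 = - 1" "y\<^sup>2 \<noteq> 1" "H 1 y = s"
      thus "H 1 (y ^ 3) = s"
        using H_tenth_root_21(1)[OF p40, of y] by simp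
    qed
    thus "G p \<zeta> = (- 1) ^ card {k. 1 \<le> k \<and> k \<le> (p + 9) div 10 \<and> Legendre (int k) (int p) = - 1}"
      by (simp only: G_eq_H)
  next
    assume "[p = 29] (mod 40)"
    hence p40: "p mod 40 = 29"
      by (simp add: cong_def)
    then obtain q where q: "p = 40 * q + 29"
      using mult_div_mod_eq[of 40 p] by metis
    have p: "p mod 8 = 5" "p mod 5 = 1 \<or> p mod 5 = 4"
      unfolding q by presburger+
    \<comment> \<open>Here \<open>c ^ 7 = - (c\<^sup>2)\<close>, so \<open>u\<close> is
      \<open>c\<^sup>2\<close>, the source of the factor \<open>\<zeta>\<^sup>2\<close>.\<close>
    have "c ^ ((p - 1) div 4) = c ^ (10 * q + 7)"
      by (rule arg_cong[where f = "\<lambda>n. c ^ n"]) (simp add: q)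
    also have "\<dots> = - (c\<^sup>2)"
      using tenth_root_power[OF c(1)] power_add[of c 5 2] c(1) by simp
    finally have "c ^ ((p - 1) div 4) = - (c\<^sup>2)" .
    moreover have "(H 1 c)\<^sup>2 = (c\<^sup>2)\<^sup>2"
      using H_tenth_root_29(2)[OF p40 c] by (simp flip: power_mult)
    moreover have "10 * Suc (4 * q + 2) = p + 1 \<or> 10 * Suc (4 * q + 2) = p + 9"
      by (simp add: q)
    moreover have Suc_div: "(p + 1) div 10 = Suc (4 * q + 2)"
      by (simp add: q)
    ultimately have Hc: "H 1 (cis (pi / 5))
        = (- 1) ^ card {k. 1 \<le> k \<and> k \<le> (p + 1) div 10 \<and> Legendre (int k) (int p) = - 1} * (cis (pi / 5))\<^sup>2"
      unfolding Suc_div c_def using p assms(2) by (intro tenth_root_sign)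
    have "H 1 \<zeta> = (- 1) ^ card {k. 1 \<le> k \<and> k \<le> (p + 1) div 10 \<and> Legendre (int k) (int p) = - 1} * \<zeta>\<^sup>2"
    proof (rule primitive_tenth_root_induct[OF assms(3)])
      fix y s :: complex
      assume y: "y ^ 5 = - 1" "y\<^sup>2 \<noteq> 1" "H 1 y = s * y\<^sup>2"
      \<comment> \<open>The shape \<open>s * y\<^sup>2\<close> survives cubing with the same
        \<open>s\<close>: the factor \<open>y ^ 4\<close> turns \<open>y\<^sup>2\<close> into
        \<open>y ^ 6\<close>.\<close>
      have "H 1 (y ^ 3) = s * (y ^ 4 * y\<^sup>2)"
        unfolding H_tenth_root_29(1)[OF p40 y(1,2)] y(3) by (simp only: mult_ac)
      thus "H 1 (y ^ 3) = s * (y ^ 3)\<^sup>2"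
        by (simp flip: power_mult power_add)
    qed (rule Hc)
    thus "G p \<zeta> = (- 1) ^ card {k. 1 \<le> k \<and> k \<le> (p + 1) div 10 \<and> Legendre (int k) (int p) = - 1} * \<zeta> ^ 2"
      by (simp only: G_eq_H)
  qed
qed

end
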